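(* For all integers $m,n\geq 2$, $$\zeta(n)=m^n\sum_{k\geq1}\frac{\mu(k)}{k}\sum_{r=0}^{nk-1}\log\left(\Gamma\left(1-\frac{e\left(\frac{r}{nk}\right)}{m}\right)\right).$$
   Context: $\zeta$ is the Riemann zeta function, $\mu$ is the classical Möbius function, $\Gamma$ is Euler's gamma function, $e(x):=e^{2\pi i x}$, and $\log$ is the principal branch of the logarithm. *)

theory Defs
  imports
    "HOL-Analysis.Analysis"
    "HOL-Computational_Algebra.Computational_Algebra"
begin

(* The Riemann zeta function on the half-plane Re s > 1, where its Dirichlet series converges.
   The analytic continuation is not modelled: values for Re s <= 1 carry no meaning. *)
definition zeta :: "complex \<Rightarrow> complex" where
  "zeta s = (\<Sum>k. 1 / of_nat (Suc k) powr s)"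

definition moebius_mu :: "nat \<Rightarrow> int" where
  "moebius_mu n = (if squarefree n then (-1) ^ card (prime_factors n) else 0)"

definition unit_exp :: "real \<Rightarrow> complex" where
  "unit_exp x = exp (2 * of_real pi * \<i> * of_real x)"

(* The k-th term of the outer series; ln on the complex numbers is the principal branch, with
   imaginary part in (-pi, pi], applied to the value of Gamma (not ln_Gamma). *)
definition gamma_term :: "nat \<Rightarrow> nat \<Rightarrow> nat \<Rightarrow> complex" where
  "gamma_term m n k =
     of_int (moebius_mu k) / of_nat k *
     (\<Sum>r<n * k. ln (Gamma (1 - unit_exp (real r / real (n * k)) / of_nat m)))"

end

theory Submission
  imports Defs
begin

text \<open>
  Write $x = 1/m$ and $y_q = (x/q)^n$ for $q \ge 1$, so that $\sum_q y_q = m^{-n} \zeta(n)$.  Let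
  $N = nk$.  The Weierstrass product gives
  $\log\Gamma(1-z) = \gamma z + \sum_q (-\log(1-z/q) - z/q)$, where for $|z| \le 1/2$ the sum on the
  right is small enough to be the principal logarithm (\<open>ln_Gamma_one_minus_sums\<close>).  Put
  $z = \omega x$ and sum over the $N$-th roots of unity $\omega$: all terms linear in $\omega$
  cancel since $N \ge 2$, and the logarithms combine by $\prod_\omega (1 - \omega x/q) = 1 - (x/q)^N$
  (\<open>sum_ln_roots_of_unity\<close>).  Hence the inner sum of the theorem is
  $\sum_q -\log(1 - y_q^k) = \sum_q \sum_l y_q^{kl}/l$
  (\<open>sum_ln_Gamma_roots_of_unity_sums\<close>).

  The series is therefore the triple sum of $\frac{\mu(k)}{kl} y_q^{kl}$.  It converges absolutely
  (\<open>triple_series_summable\<close>), so the sum over $k$ and $l$ can be taken first.  Collecting the terms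
  with $kl = j$ gives $\frac{y_q^j}{j} \sum_{k \mid j} \mu(k)$, which vanishes unless $j = 1$;
  what remains is $\sum_q y_q$ (\<open>moebius_lambert_has_sum\<close>).
\<close>

section \<open>Divisor sums of the Moebius function\<close>

text \<open>The inverse map sends a set of primes to its product.\<close>
lemma bij_betw_squarefree_divisors:
  fixes n :: nat
  assumes "n > 0"
  shows "bij_betw prime_factors {d. d dvd n \<and> squarefree d} (Pow (prime_factors n))"
proof (rule bij_betwI[where g = "\<lambda>X. \<Prod>X"])
  show "prime_factors \<in> {d. d dvd n \<and> squarefree d} \<rightarrow> Pow (prime_factors n)"
    using assms dvd_prime_factors by (metis (no_types, lifting) PowI Pi_I mem_Collect_eq neq0_conv)
next
  have prime: "prime p" if "X \<in> Pow (prime_factors n)" "p \<in> X" for X p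
    using that by auto
  have finite: "finite X" if "X \<in> Pow (prime_factors n)" for X
    using that finite_subset by blast
  have sqf: "squarefree (\<Prod>X)" if "X \<in> Pow (prime_factors n)" for X
    using prime[OF that] by (intro squarefree_prod_coprime) (auto intro: primes_coprime squarefree_prime)
  show "(\<lambda>X. \<Prod>X) \<in> Pow (prime_factors n) \<rightarrow> {d. d dvd n \<and> squarefree d}"
  proof (intro Pi_I CollectI conjI)
    fix X assume X: "X \<in> Pow (prime_factors n)"
    show "squarefree (\<Prod>X)" by (rule sqf[OF X])
    have "(\<Prod>X) dvd (\<Prod>p\<in>X. p ^ multiplicity p n)"
    proof (rule prod_dvd_prod)
      fix p assume "p \<in> X"
      hence "multiplicity p n > 0"
        using X by (auto simp: prime_factors_multiplicity)
      thus "p dvd p ^ multiplicity p n" by (simp add: dvd_power)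
    qed
    also have "\<dots> dvd (\<Prod>p\<in>prime_factors n. p ^ multiplicity p n)"
      using X by (intro prod_dvd_prod_subset) auto
    also have "\<dots> = n"
      using assms by (subst prod_prime_factors) auto
    finally show "\<Prod>X dvd n" .
  qed
  fix X assume X: "X \<in> Pow (prime_factors n)"
  show "prime_factors (\<Prod>X) = X"
  proof -
    have "0 \<notin> X" using prime[OF X, of 0] by auto
    hence "prime_factors (\<Prod>X) = (\<Union>p\<in>X. prime_factors p)"
      using finite[OF X] by (subst prime_factors_prod) auto
    also have "\<dots> = (\<Union>p\<in>X. {p})"
      using prime[OF X] by (intro SUP_cong) (auto simp: prime_prime_factors)
    finally show ?thesis by simp
  qed
next
  fix d assume d: "d \<in> {d. d dvd n \<and> squarefree d}"
  hence "d \<noteq> 0" using assms by auto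
  hence "d = (\<Prod>p\<in>prime_factors d. p ^ multiplicity p d)"
    by (subst prod_prime_factors) auto
  also have "\<dots> = \<Prod>(prime_factors d)"
    using d \<open>d \<noteq> 0\<close> by (intro prod.cong) (auto simp: squarefree_factorial_semiring')
  finally show "\<Prod>(prime_factors d) = d" by simp
qed

lemma sum_moebius_mu_divisors:
  assumes "n > 0"
  shows "(\<Sum>d | d dvd n. moebius_mu d) = (if n = 1 then 1 else 0)"
proof -
  have "(\<Sum>d | d dvd n. moebius_mu d) = (\<Sum>d | d dvd n \<and> squarefree d. (-1) ^ card (prime_factors d))"
    using assms by (intro sum.mono_neutral_cong_right) (auto simp: moebius_mu_def)
  also have "\<dots> = (\<Sum>X\<in>Pow (prime_factors n). (-1) ^ card X)"
    by (rule sum.reindex_bij_betw[OF bij_betw_squarefree_divisors[OF assms]])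
  also have "\<dots> = (\<Prod>p\<in>prime_factors n. 1 - 1 :: int)"
    using prod_diff_conv_sum[of "prime_factors n" "\<lambda>_. 1 :: int" "\<lambda>_. 1"] by simp
  also have "\<dots> = (if prime_factors n = {} then 1 else 0)"
    by (simp add: card_gt_0_iff)
  also have "prime_factors n = {} \<longleftrightarrow> n = 1"
    using assms by (auto simp: prime_factorization_empty_iff)
  finally show ?thesis .
qed

text \<open>This is the identity $\sum_k \frac{\mu(k)}{k} (-\log(1 - z^k)) = z$ with the logarithm
  expanded, valid whenever the double series converges absolutely.
  The indices of the double series are shifted by one, so that they start at 0.\<close>
lemma moebius_lambert_has_sum:
  fixes z :: complex
  defines "f \<equiv> \<lambda>(k, l). of_int (moebius_mu (Suc k)) / of_nat (Suc k * Suc l) * z ^ (Suc k * Suc l)"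
  assumes "f summable_on UNIV"
  shows "(f has_sum z) UNIV"
proof -
  obtain S where S: "(f has_sum S) UNIV"
    using assms(2) by (auto simp: summable_on_def)
  let ?B = "\<lambda>j. {k. Suc k dvd Suc j}"
  define g where "g = (\<lambda>(j, k). of_int (moebius_mu (Suc k)) / of_nat (Suc j) * z ^ Suc j)"
  \<comment> \<open>Group the terms by the product of the two indices, which is \<open>Suc j\<close>.\<close>
  have "(f has_sum S) UNIV \<longleftrightarrow> (g has_sum S) (Sigma UNIV ?B)"
  proof (rule has_sum_reindex_bij_witness[where
        i = "\<lambda>(j, k). (k, Suc j div Suc k - 1)" and j = "\<lambda>(k, l). (Suc k * Suc l - 1, k)"])
    fix b assume "b \<in> Sigma UNIV ?B"
    then obtain j k where b: "b = (j, k)" "Suc k dvd Suc j" by auto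
    then obtain c where c: "Suc j = Suc k * c" by (elim dvdE)
    then obtain l where l: "c = Suc l" by (cases c) auto
    have "Suc j div Suc k - 1 = l"
      unfolding c l by (simp del: mult_Suc mult_Suc_right)
    moreover have "Suc k * Suc l - 1 = j"
      using c by (simp add: l)
    ultimately
    show "(case case b of (j, k) \<Rightarrow> (k, Suc j div Suc k - 1) of (k, l) \<Rightarrow> (Suc k * Suc l - 1, k)) = b"
      using b by (simp del: mult_Suc mult_Suc_right)
  next
    fix a :: "nat \<times> nat"
    obtain k l where a: "a = (k, l)" by (cases a)
    have s: "Suc (Suc k * Suc l - 1) = Suc k * Suc l" by simp
    show "(case case a of (k, l) \<Rightarrow> (Suc k * Suc l - 1, k) of (j, k) \<Rightarrow> (k, Suc j div Suc k - 1)) = a"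
      unfolding a prod.case s by (simp del: mult_Suc mult_Suc_right)
    show "(case a of (k, l) \<Rightarrow> (Suc k * Suc l - 1, k)) \<in> Sigma UNIV ?B"
      unfolding a prod.case mem_Sigma_iff mem_Collect_eq s by (simp del: mult_Suc mult_Suc_right)
    show "g (case a of (k, l) \<Rightarrow> (Suc k * Suc l - 1, k)) = f a"
      unfolding a prod.case g_def f_def s by simp
  qed auto
  hence "(g has_sum S) (Sigma UNIV ?B)" using S by simp
  hence "((\<lambda>j::nat. if j = 0 then z else 0) has_sum S) UNIV"
  proof (rule has_sum_SigmaD)
    fix j :: nat
    have "Suc (d - 1) = d" if "d dvd Suc j" for d
      using that by (cases d) auto
    hence bij: "bij_betw Suc (?B j) {d. d dvd Suc j}"
      by (intro bij_betwI[where g = "\<lambda>d. d - 1"]) auto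
    have fin: "finite (?B j)"
      using bij_betw_finite[OF bij] by simp
    have "(\<Sum>k\<in>?B j. g (j, k)) = of_int (\<Sum>k\<in>?B j. moebius_mu (Suc k)) / of_nat (Suc j) * z ^ Suc j"
      by (simp add: g_def sum_distrib_right sum_divide_distrib del: power_Suc of_nat_Suc)
    also have "(\<Sum>k\<in>?B j. moebius_mu (Suc k)) = (\<Sum>d | d dvd Suc j. moebius_mu d)"
      by (rule sum.reindex_bij_betw[OF bij])
    also have "\<dots> = (if j = 0 then 1 else 0)"
      by (subst sum_moebius_mu_divisors) auto
    finally show "((\<lambda>k. g (j, k)) has_sum (if j = 0 then z else 0)) (?B j)"
      using fin by (intro has_sum_finiteI) auto
  qed
  hence "(\<lambda>j::nat. if j = 0 then z else 0) sums S" by (rule has_sum_imp_sums)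
  moreover have "(\<lambda>j::nat. if j = 0 then z else 0) sums z"
    using sums_single[of 0 "\<lambda>_. z"] by simp
  ultimately show ?thesis using S sums_unique2 by blast
qed

section \<open>Roots of unity\<close>

lemma unit_exp_power:
  assumes "N > 0"
  shows "unit_exp (real r / real N) ^ j = (unit_exp (1 / real N) ^ j) ^ r"
  by (simp add: unit_exp_def mult_ac flip: exp_of_nat_mult)

lemma norm_unit_exp [simp]: "norm (unit_exp x) = 1"
  by (simp add: unit_exp_def norm_exp_eq_Re)

lemma sum_unit_exp_power:
  assumes "N > 0"
  shows "(\<Sum>r<N. unit_exp (real r / real N) ^ j) = (if N dvd j then of_nat N else 0)"
proof -
  define w where "w = unit_exp (1 / real N) ^ j"
  have "w = exp (2 * of_real pi * \<i> * of_nat j / of_nat N)"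
    by (simp add: w_def unit_exp_def mult_ac flip: exp_of_nat_mult)
  hence w1: "w = 1 \<longleftrightarrow> N dvd j"
    using complex_root_unity_eq_1[of N j] assms by simp
  have "w ^ N = unit_exp 1 ^ j"
    using unit_exp_power[OF assms, of N j] assms by (simp add: w_def)
  hence wN: "w ^ N = 1" by (simp add: unit_exp_def)
  have "(\<Sum>r<N. unit_exp (real r / real N) ^ j) = (\<Sum>r<N. w ^ r)"
    using assms by (simp add: w_def unit_exp_power)
  also have "\<dots> = (if N dvd j then of_nat N else 0)"
    using w1 wN by (simp add: sum_gp_strict)
  finally show ?thesis .
qed

text \<open>This is the factorisation of $1 - x^N$ over the roots of unity, on the level of principal
  logarithms.  Comparing power series avoids having to track branches: averaging over the roots
  of unity keeps exactly the powers $x^j$ with $N \mid j$.\<close>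
lemma sum_ln_roots_of_unity:
  fixes x :: complex
  assumes "norm x < 1" and "N > 0"
  shows "(\<Sum>r<N. ln (1 - unit_exp (real r / real N) * x)) = ln (1 - x ^ N)"
proof -
  have ln: "(\<lambda>j. - (u ^ j) / of_nat j) sums ln (1 - u)" if "norm u < 1" for u :: complex
    using Ln_series'[of "-u"] that by simp
  have "(\<lambda>j. \<Sum>r<N. - ((unit_exp (real r / real N) * x) ^ j) / of_nat j)
          sums (\<Sum>r<N. ln (1 - unit_exp (real r / real N) * x))"
    using assms by (intro sums_sum ln) (simp add: norm_mult)
  also have "(\<lambda>j. \<Sum>r<N. - ((unit_exp (real r / real N) * x) ^ j) / of_nat j) =
        (\<lambda>j. if N dvd j then - (of_nat N * x ^ j) / of_nat j else 0)"
  proof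
    fix j
    have "(\<Sum>r<N. - ((unit_exp (real r / real N) * x) ^ j) / of_nat j) =
            - ((\<Sum>r<N. unit_exp (real r / real N) ^ j) * x ^ j) / of_nat j"
      by (simp add: power_mult_distrib sum_distrib_right sum_negf flip: sum_divide_distrib)
    thus "(\<Sum>r<N. - ((unit_exp (real r / real N) * x) ^ j) / of_nat j) =
        (if N dvd j then - (of_nat N * x ^ j) / of_nat j else 0)"
      using assms by (simp add: sum_unit_exp_power)
  qed
  finally have "(\<lambda>j. if N dvd j then - (of_nat N * x ^ j) / of_nat j else 0)
      sums (\<Sum>r<N. ln (1 - unit_exp (real r / real N) * x))" .
  moreover have "strict_mono (\<lambda>l. N * l)"
    using assms by (auto simp: strict_mono_def)
  ultimately have "(\<lambda>l. (\<lambda>j. if N dvd j then - (of_nat N * x ^ j) / of_nat j else 0) (N * l))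
      sums (\<Sum>r<N. ln (1 - unit_exp (real r / real N) * x))"
    by (subst sums_mono_reindex) (auto simp: dvd_def)
  hence "(\<lambda>l. - ((x ^ N) ^ l) / of_nat l) sums (\<Sum>r<N. ln (1 - unit_exp (real r / real N) * x))"
    using assms by (simp add: power_mult)
  moreover have "norm (x ^ N) < 1"
    using assms by (simp add: norm_power power_less_one_iff)
  ultimately show ?thesis
    using ln sums_unique2 by blast
qed

section \<open>The principal logarithm of the Gamma function\<close>

text \<open>Exponentiating the series recovers the Weierstrass product, so \<open>L\<close> below, which is
  the series plus the term with the Euler--Mascheroni constant, is one logarithm of
  $\Gamma(1-z)$.  The bound on $|z|$ gives $|L| \le 1/2 + \pi/3 < \pi$, which makes it the
  principal one.\<close>
lemma ln_Gamma_one_minus_sums: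
  fixes z :: complex
  assumes "norm z \<le> 1 / 2"
  shows "(\<lambda>k. - ln (1 - z / of_nat (Suc k)) - z / of_nat (Suc k))
           sums (ln (Gamma (1 - z)) - euler_mascheroni * z)"
proof (cases "z = 0")
  case True
  thus ?thesis by simp
next
  case False
  define t where "t = (\<lambda>k. - ln (1 - z / of_nat (Suc k)) - z / of_nat (Suc k))"
  have nz: "norm (z / of_nat (Suc k)) \<le> (1/2) / real (Suc k)" for k
    unfolding norm_divide norm_of_nat using assms by (intro divide_right_mono) auto
  have nz': "norm (z / of_nat (Suc k)) \<le> 1 / 2" for k
  proof (rule order.trans[OF nz])
    show "(1/2) / real (Suc k) \<le> 1 / 2" by simp
  qed
  have t_le: "norm (t k) \<le> 1 / real (Suc k) ^ 2 / 2" for k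
  proof -
    define u where "u = z / of_nat (Suc k)"
    have u: "norm u \<le> (1/2) / real (Suc k)" "norm u \<le> 1/2"
      using nz nz' by (simp_all add: u_def)
    have "norm (t k) = norm (ln (1 + (-u)) - (-u))"
      by (subst norm_minus_cancel[symmetric]) (simp add: t_def u_def)
    also have "\<dots> \<le> norm (-u) ^ 2 / (1 - norm (-u))"
      using u by (intro Ln_approx_linear) simp
    also have "\<dots> \<le> norm u ^ 2 / (1/2)"
      using u by (intro frac_le) auto
    also have "\<dots> \<le> ((1/2) / real (Suc k)) ^ 2 / (1/2)"
      using u by (intro divide_right_mono power_mono) auto
    also have "\<dots> = 1 / real (Suc k) ^ 2 / 2"
      by (simp add: power_divide power2_eq_square del: of_nat_Suc)
    finally show ?thesis .
  qed
  have bound: "(\<lambda>k. 1 / real (Suc k) ^ 2 / 2) sums (pi\<^sup>2 / 6 / 2)"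
    using inverse_squares_sums by (intro sums_divide) simp
  have summ: "summable (\<lambda>k. norm (t k))"
    by (rule summable_comparison_test[OF _ sums_summable[OF bound]]) (use t_le in auto)
  define L where "L = euler_mascheroni * z + suminf t"
  have "norm (suminf t) \<le> (\<Sum>k. norm (t k))"
    by (rule summable_norm[OF summ])
  also have "\<dots> \<le> (\<Sum>k. 1 / real (Suc k) ^ 2 / 2)"
    using t_le by (intro suminf_le summ sums_summable[OF bound])
  also have "\<dots> = pi\<^sup>2 / 12"
    using sums_unique[OF bound] by simp
  also have "\<dots> \<le> pi / 3"
    using pi_less_4 pi_gt_zero by (simp add: power2_eq_square)
  finally have "norm (suminf t) \<le> pi / 3" .
  moreover have "norm (euler_mascheroni * z) \<le> 1 * (1/2)"
  proof -
    have "norm (euler_mascheroni :: complex) = \<bar>euler_mascheroni :: real\<bar>"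
      using norm_of_real[of euler_mascheroni, where 'a = complex]
      by (simp only: of_real_euler_mascheroni)
    also have "\<dots> \<le> 1"
      using euler_mascheroni_pos euler_mascheroni_less_13_over_22 by simp
    finally show ?thesis unfolding norm_mult using assms by (intro mult_mono) auto
  qed
  ultimately have "norm L \<le> 1/2 + pi / 3"
    unfolding L_def by (intro order.trans[OF norm_triangle_ineq]) simp
  hence "\<bar>Im L\<bar> < pi"
    using abs_Im_le_cmod[of L] pi_gt3 by simp
  moreover have "exp L = Gamma (1 - z)"
  proof -
    have ne: "1 - z / of_nat (Suc k) \<noteq> 0" for k
    proof
      assume "1 - z / of_nat (Suc k) = 0"
      hence "norm (z / of_nat (Suc k)) = norm (1 :: complex)" by (metis eq_iff_diff_eq_0)
      with nz'[of k] show False by simp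
    qed
    have "(\<lambda>n. exp (euler_mascheroni * z + (\<Sum>k<n. t k))) \<longlonglongrightarrow> exp L"
      unfolding L_def
      by (intro tendsto_intros summable_LIMSEQ summable_norm_cancel[OF summ])
    moreover have "(\<lambda>n. (-z) * Gamma_series_Weierstrass (-z) n) \<longlonglongrightarrow> (-z) * Gamma (-z)"
      by (intro tendsto_intros Gamma_Weierstrass_complex)
    moreover have "(-z) * Gamma_series_Weierstrass (-z) n = exp (euler_mascheroni * z + (\<Sum>k<n. t k))"
      for n
    proof -
      have "exp (t k) = exp ((-z) / of_nat (Suc k)) / (1 + (-z) / of_nat (Suc k))" for k
      proof -
        define u where "u = z / of_nat (Suc k)"
        have "exp (- ln (1 - u) - u) = exp (- u) / (1 + - u)"
          using ne[of k] unfolding u_def[symmetric] by (simp add: exp_diff exp_minus divide_inverse)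
        thus ?thesis by (simp add: t_def u_def del: of_nat_Suc)
      qed
      hence "exp (\<Sum>k<n. t k) = (\<Prod>k<n. exp ((-z) / of_nat (Suc k)) / (1 + (-z) / of_nat (Suc k)))"
        by (simp add: exp_sum)
      also have "\<dots> = (\<Prod>k=1..n. exp ((-z) / of_nat k) / (1 + (-z) / of_nat k))"
        by (simp add: prod.atLeast1_atMost_eq)
      finally show ?thesis
        using False by (simp add: Gamma_series_Weierstrass_def exp_add)
    qed
    ultimately have "exp L = (-z) * Gamma (-z)"
      using LIMSEQ_unique by auto
    also have "\<dots> = Gamma (-z + 1)"
      using assms False by (intro Gamma_plus1[symmetric]) (auto elim!: nonpos_Ints_cases')
    finally show ?thesis by simp
  qed
  ultimately have "ln (Gamma (1 - z)) = L"
    by (intro Ln_unique) auto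
  thus ?thesis
    using summable_sums[OF summable_norm_cancel[OF summ]] unfolding L_def t_def by simp
qed

lemma sum_ln_Gamma_roots_of_unity_sums:
  fixes x :: complex
  assumes "norm x \<le> 1 / 2" and "N \<ge> 2"
  shows "(\<lambda>q. - ln (1 - (x / of_nat (Suc q)) ^ N))
           sums (\<Sum>r<N. ln (Gamma (1 - unit_exp (real r / real N) * x)))"
proof -
  let ?w = "\<lambda>r. unit_exp (real r / real N)"
  \<comment> \<open>Since $N \ge 2$, the roots of unity sum to zero, which removes all linear terms.\<close>
  have w0: "(\<Sum>r<N. ?w r) = 0"
    using sum_unit_exp_power[of N 1] assms by simp
  have w0': "(\<Sum>r<N. ?w r * c) = 0" for c
    using w0 by (simp flip: sum_distrib_right)
  have "(\<lambda>q. \<Sum>r<N. - ln (1 - ?w r * x / of_nat (Suc q)) - ?w r * x / of_nat (Suc q))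
          sums (\<Sum>r<N. ln (Gamma (1 - ?w r * x)) - euler_mascheroni * (?w r * x))"
    using assms by (intro sums_sum ln_Gamma_one_minus_sums) (simp add: norm_mult)
  also have "(\<Sum>r<N. ln (Gamma (1 - ?w r * x)) - euler_mascheroni * (?w r * x)) =
               (\<Sum>r<N. ln (Gamma (1 - ?w r * x)))"
    using w0' by (simp add: sum_subtractf flip: sum_distrib_left)
  also have "(\<lambda>q. \<Sum>r<N. - ln (1 - ?w r * x / of_nat (Suc q)) - ?w r * x / of_nat (Suc q)) =
               (\<lambda>q. - ln (1 - (x / of_nat (Suc q)) ^ N))"
  proof
    fix q
    have "norm (x / of_nat (Suc q)) \<le> norm x / 1"
      unfolding norm_divide norm_of_nat by (intro divide_left_mono) auto
    hence "norm (x / of_nat (Suc q)) < 1" using assms by simp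
    hence "(\<Sum>r<N. ln (1 - ?w r * (x / of_nat (Suc q)))) = ln (1 - (x / of_nat (Suc q)) ^ N)"
      using assms by (intro sum_ln_roots_of_unity) auto
    thus "(\<Sum>r<N. - ln (1 - ?w r * x / of_nat (Suc q)) - ?w r * x / of_nat (Suc q)) =
            - ln (1 - (x / of_nat (Suc q)) ^ N)"
      using w0'[of "x / of_nat (Suc q)"] by (simp add: sum_subtractf sum_negf del: of_nat_Suc)
  qed
  finally show ?thesis .
qed

section \<open>Moebius inversion of the triple series\<close>

lemma summable_on_times_nonneg:
  fixes f :: "'a \<Rightarrow> real" and g :: "'b \<Rightarrow> real"
  assumes "f summable_on A" and "g summable_on B"
    and "\<And>x. x \<in> A \<Longrightarrow> f x \<ge> 0" and "\<And>y. y \<in> B \<Longrightarrow> g y \<ge> 0"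
  shows "(\<lambda>(x, y). f x * g y) summable_on A \<times> B"
proof (rule summable_on_SigmaI)
  fix x
  show "((\<lambda>y. case (x, y) of (x, y) \<Rightarrow> f x * g y) has_sum f x * infsum g B) B"
    using has_sum_cmult_right[OF has_sum_infsum[OF assms(2)]] by simp
next
  show "(\<lambda>x. f x * infsum g B) summable_on A"
    by (rule summable_on_cmult_left[OF assms(1)])
qed (use assms in auto)

text \<open>In indices starting at 1, the bound $|y_q|^{kl} \le 4^{-kl} q^{-2} \le 2^{-k-l} q^{-2}$
  gives a product of three convergent series as a majorant.\<close>
lemma triple_series_summable:
  fixes y :: "nat \<Rightarrow> complex"
  assumes "\<And>q. norm (y q) \<le> 1 / 4 / real (Suc q) ^ 2"
  shows "(\<lambda>(q, k, l). of_int (moebius_mu (Suc k)) / of_nat (Suc k * Suc l) * y q ^ (Suc k * Suc l))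
           summable_on UNIV"
proof -
  define b where "b = (\<lambda>(q, k, l). 1 / real (Suc q) ^ 2 * ((1/2) ^ k * (1/2) ^ l))"
  have geom: "(\<lambda>k. (1/2::real) ^ k) summable_on UNIV"
    by (rule norm_summable_imp_summable_on) (simp add: norm_power summable_geometric)
  have sq: "(\<lambda>q. 1 / real (Suc q) ^ 2) summable_on UNIV"
    using inverse_squares_sums by (intro norm_summable_imp_summable_on) (auto simp: sums_iff)
  have "(\<lambda>(k, l). (1/2::real) ^ k * (1/2) ^ l) summable_on UNIV \<times> UNIV"
    using summable_on_times_nonneg[OF geom geom] by simp
  from summable_on_times_nonneg[OF sq this]
  have "b summable_on UNIV"
    by (simp add: b_def case_prod_unfold)
  hence "(\<lambda>a. norm (case a of (q, k, l) \<Rightarrow>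
      of_int (moebius_mu (Suc k)) / of_nat (Suc k * Suc l) * y q ^ (Suc k * Suc l))) summable_on UNIV"
  proof (rule Infinite_Sum.abs_summable_on_comparison_test')
    fix a :: "nat \<times> nat \<times> nat"
    obtain q k l where a: "a = (q, k, l)" by (cases a)
    define j where "j = Suc k * Suc l"
    have j: "j > 0" "k + l \<le> 2 * j" by (auto simp: j_def)
    have "norm (of_int (moebius_mu (Suc k)) / of_nat j :: complex) \<le> 1"
    proof -
      have "\<bar>real_of_int (moebius_mu (Suc k))\<bar> \<le> 1" by (simp add: moebius_mu_def)
      moreover have "1 \<le> real j" using j by simp
      ultimately show ?thesis
        unfolding norm_divide norm_of_int norm_of_nat by (simp add: divide_le_eq_1)
    qed
    moreover have "norm (y q ^ j) \<le> 1 / real (Suc q) ^ 2 * ((1/2) ^ k * (1/2) ^ l)"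
    proof -
      define s where "s = 1 / real (Suc q) ^ 2"
      have s: "0 \<le> s" "s \<le> 1" by (simp_all add: s_def)
      have "norm (y q ^ j) \<le> (1 / 4 * s) ^ j"
        unfolding norm_power using assms[of q] by (intro power_mono) (simp_all add: s_def)
      also have "\<dots> = (1/2) ^ (2 * j) * s ^ j"
        by (simp only: power_mult power_mult_distrib) (simp add: power2_eq_square)
      also have "\<dots> \<le> (1/2) ^ (k + l) * s ^ 1"
        using s j by (intro mult_mono power_decreasing) auto
      finally show ?thesis by (simp only: s_def power_add power_one_right mult_ac)
    qed
    ultimately have "norm (of_int (moebius_mu (Suc k)) / of_nat j * y q ^ j)
        \<le> 1 * (1 / real (Suc q) ^ 2 * ((1/2) ^ k * (1/2) ^ l))"
      unfolding norm_mult by (intro mult_mono) auto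
    thus "norm (case a of (q, k, l) \<Rightarrow>
        of_int (moebius_mu (Suc k)) / of_nat (Suc k * Suc l) * y q ^ (Suc k * Suc l)) \<le> b a"
      unfolding a b_def prod.case j_def by simp
  qed
  thus ?thesis by (rule abs_summable_summable)
qed

theorem corollary3:
  fixes m n :: nat
  assumes "m \<ge> 2" and "n \<ge> 2"
  shows "summable (\<lambda>k. gamma_term m n (Suc k)) \<and>
         zeta (of_nat n) = of_nat m ^ n * (\<Sum>k. gamma_term m n (Suc k))"
proof -
  define x where "x = (1 / of_nat m :: complex)"
  define y where "y = (\<lambda>q. (x / of_nat (Suc q)) ^ n)"
  define f where "f = (\<lambda>(q, k, l).
    of_int (moebius_mu (Suc k)) / of_nat (Suc k * Suc l) * y q ^ (Suc k * Suc l) :: complex)"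
  have x: "norm x \<le> 1 / 2"
    using assms by (simp add: x_def norm_divide divide_simps)
  have y_le: "norm (y q) \<le> 1 / 4 / real (Suc q) ^ 2" for q
  proof -
    have "norm x / real (Suc q) \<le> (1 / 2) / real (Suc q)"
      using x by (intro divide_right_mono) auto
    moreover have "(1 / 2) / real (Suc q) \<le> 1" by simp
    ultimately have "norm (y q) \<le> ((1 / 2) / real (Suc q)) ^ 2"
      unfolding y_def norm_power norm_divide norm_of_nat
      by (intro order.trans[OF power_mono power_decreasing]) (use assms in auto)
    also have "\<dots> = 1 / 4 / real (Suc q) ^ 2"
      by (simp add: power_divide power2_eq_square del: of_nat_Suc)
    finally show ?thesis .
  qed
  have y_less: "norm (y q) < 1" for q
  proof -
    have "1 / 4 / real (Suc q) ^ 2 \<le> 1 / 4 / 1" by (intro divide_left_mono) auto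
    hence "norm (y q) \<le> 1 / 4 / 1" by (rule order.trans[OF y_le])
    thus ?thesis by simp
  qed
  obtain S where S: "(f has_sum S) (UNIV \<times> UNIV)"
    using triple_series_summable[OF y_le] unfolding summable_on_def f_def by auto

  \<comment> \<open>Summing the triple series over $k$ and $l$ first yields $m^{-n}\zeta(n)$ \<dots>\<close>
  have "(y has_sum S) UNIV"
    using S
  proof (rule has_sum_SigmaD)
    fix q :: nat
    have "(\<lambda>(q, p). f (q, p)) summable_on UNIV \<times> UNIV"
      using S unfolding summable_on_def by auto
    hence "(\<lambda>p. f (q, p)) summable_on UNIV" by (rule summable_on_SigmaD1) simp
    thus "((\<lambda>p. f (q, p)) has_sum y q) UNIV"
      using moebius_lambert_has_sum[of "y q"] by (simp add: f_def)
  qed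
  hence "y sums S" by (rule has_sum_imp_sums)
  hence "(\<lambda>q. of_nat m ^ n * y q) sums (of_nat m ^ n * S)" by (rule sums_mult)
  moreover have "of_nat m ^ n * y q = 1 / of_nat (Suc q) powr of_nat n" for q
    using assms by (simp add: y_def x_def power_divide power_mult_distrib powr_nat' del: of_nat_Suc)
  ultimately have zeta: "zeta (of_nat n) = of_nat m ^ n * S"
    unfolding zeta_def using sums_unique by force

  \<comment> \<open>\<dots> and summing it over $q$ and $l$ first yields the series of the theorem.\<close>
  have "bij_betw (\<lambda>(k, q, l). (q, k, l)) (UNIV \<times> UNIV) (UNIV \<times> (UNIV :: (nat \<times> nat) set))"
    by (rule bij_betwI[where g = "\<lambda>(q, k, l). (k, q, l)"]) auto
  from has_sum_reindex_bij_betw[OF this, of f S] S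
  have S': "((\<lambda>(k, q, l). f (q, k, l)) has_sum S) (UNIV \<times> UNIV)"
    by (simp add: case_prod_unfold)
  have "((\<lambda>k. gamma_term m n (Suc k)) has_sum S) UNIV"
    using S'
  proof (rule has_sum_SigmaD)
    fix k :: nat
    define c where "c = (of_int (moebius_mu (Suc k)) / of_nat (Suc k) :: complex)"
    have "(\<lambda>(k, p). case p of (q, l) \<Rightarrow> f (q, k, l)) summable_on UNIV \<times> UNIV"
      using S' unfolding summable_on_def by auto
    hence "(\<lambda>(q, l). f (q, k, l)) summable_on UNIV" by (rule summable_on_SigmaD1) simp
    \<comment> \<open>The value of this double sum is identified by summing over $l$, then over $q$.\<close>
    then obtain T where T: "((\<lambda>(q, l). f (q, k, l)) has_sum T) (UNIV \<times> UNIV)"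
      unfolding summable_on_def by auto
    have "((\<lambda>q. c * - ln (1 - y q ^ Suc k)) has_sum T) UNIV"
      using T
    proof (rule has_sum_SigmaD)
      fix q :: nat
      have "(\<lambda>(q, l). f (q, k, l)) summable_on UNIV \<times> UNIV"
        using T unfolding summable_on_def by auto
      hence "(\<lambda>l. f (q, k, l)) summable_on UNIV" by (rule summable_on_SigmaD1) simp
      then obtain U where U: "((\<lambda>l. f (q, k, l)) has_sum U) UNIV"
        unfolding summable_on_def by auto
      have "norm (y q ^ Suc k) < 1"
        using y_less[of q] by (simp add: norm_power power_less_one_iff del: power_Suc)
      hence "(\<lambda>l. - ((y q ^ Suc k) ^ l) / of_nat l) sums ln (1 - y q ^ Suc k)"
        using Ln_series'[of "- (y q ^ Suc k)"] by simp
      hence "(\<lambda>l. - ((y q ^ Suc k) ^ Suc l) / of_nat (Suc l)) sums ln (1 - y q ^ Suc k)"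
        by (subst sums_Suc_iff) simp
      hence "(\<lambda>l. (- c) * (- ((y q ^ Suc k) ^ Suc l) / of_nat (Suc l))) sums
               ((- c) * ln (1 - y q ^ Suc k))"
        by (rule sums_mult)
      also have "(\<lambda>l. (- c) * (- ((y q ^ Suc k) ^ Suc l) / of_nat (Suc l))) = (\<lambda>l. f (q, k, l))"
      proof
        fix l
        show "(- c) * (- ((y q ^ Suc k) ^ Suc l) / of_nat (Suc l)) = f (q, k, l)"
          unfolding f_def c_def prod.case of_nat_mult power_mult by (simp del: of_nat_Suc power_Suc)
      qed
      finally have "U = c * - ln (1 - y q ^ Suc k)"
        using has_sum_imp_sums[OF U] sums_unique2 by fastforce
      thus "((\<lambda>l. case (q, l) of (q, l) \<Rightarrow> f (q, k, l)) has_sum c * - ln (1 - y q ^ Suc k)) UNIV"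
        using U by simp
    qed
    hence "(\<lambda>q. c * - ln (1 - y q ^ Suc k)) sums T" by (rule has_sum_imp_sums)
    moreover have "(\<lambda>q. c * - ln (1 - y q ^ Suc k)) sums gamma_term m n (Suc k)"
    proof -
      have "n * Suc k \<ge> 2 * 1" using assms by (intro mult_mono) auto
      hence "(\<lambda>q. - ln (1 - (x / of_nat (Suc q)) ^ (n * Suc k))) sums
               (\<Sum>r<n * Suc k. ln (Gamma (1 - unit_exp (real r / real (n * Suc k)) * x)))"
        using x by (intro sum_ln_Gamma_roots_of_unity_sums) auto
      hence "(\<lambda>q. c * - ln (1 - (x / of_nat (Suc q)) ^ (n * Suc k))) sums
               (c * (\<Sum>r<n * Suc k. ln (Gamma (1 - unit_exp (real r / real (n * Suc k)) * x))))"
        by (rule sums_mult)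
      thus ?thesis
        unfolding gamma_term_def c_def y_def power_mult by (simp add: x_def)
    qed
    ultimately have "T = gamma_term m n (Suc k)" by (rule sums_unique2)
    thus "((\<lambda>p. case (k, p) of (k, q, l) \<Rightarrow> f (q, k, l)) has_sum gamma_term m n (Suc k)) UNIV"
      using T by simp
  qed
  hence "(\<lambda>k. gamma_term m n (Suc k)) sums S" by (rule has_sum_imp_sums)
  thus ?thesis using zeta by (simp add: sums_iff)
qed

end
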